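(* Let $\mathcal{K}\subset\mathbb{R}^N$ be a convex body. Then the Fraenkel asymmetry $\mathcal{A}(\mathcal{K})$ is attained for at least one ball centered at a point belonging to the heart $\heartsuit(\mathcal{K})$.
   Context: A convex body in $\mathbb{R}^N$ is a compact convex set with non-empty interior. $|\cdot|$ is Lebesgue measure. The Fraenkel asymmetry of $\mathcal{K}$ is $$\mathcal{A}(\mathcal{K})=\min_{x\in\mathbb{R}^N}\frac{|\mathcal{K}\,\Delta\,B(x,r^*_{\mathcal{K}})|}{|\mathcal{K}|},$$ where $\Delta$ is the symmetric difference, $B(x,r)$ is the ball of center $x$ and radius $r$, and $r^*_{\mathcal{K}}$ is determined by $|B(x,r^*_{\mathcal{K}})|=|\mathcal{K}|$; it is attained for a ball $B(x,r^*_{\mathcal{K}})$ if $x$ realizes this minimum. For $\omega\in\mathbb{S}^{N-1}$ (the unit sphere) and $\lambda\in\mathbb{R}$, $T_{\lambda,\omega}$ is the reflection of $\mathbb{R}^N$ in the hyperplane $\{x:\langle x,\omega\rangle=\lambda\}$, and $\mathcal{K}_{\lambda,\omega}=\{x\in\mathcal{K}:\langle x,\omega\rangle\ge\lambda\}$. The maximal folding function is $\mathcal{R}_{\mathcal{K}}(\omega)=\min\{\lambda\in\mathbb{R}: T_{\lambda,\omega}(\mathcal{K}_{\lambda,\omega})\subseteq\mathcal{K}\}$. The heart of $\mathcal{K}$ is $\heartsuit(\mathcal{K})=\{x\in\mathcal{K}:\langle x,\omega\rangle\le\mathcal{R}_{\mathcal{K}}(\omega)\text{ for every }\omega\in\mathbb{S}^{N-1}\}$.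 *)

theory Defs
  imports "HOL-Analysis.Analysis"
begin

definition convex_body :: "'a::euclidean_space set \<Rightarrow> bool" where
  "convex_body K \<longleftrightarrow> compact K \<and> convex K \<and> interior K \<noteq> {}"

definition eq_radius :: "'a::euclidean_space set \<Rightarrow> real" where
  "eq_radius K = (THE r. 0 \<le> r \<and> (\<forall>x::'a. measure lebesgue (ball x r) = measure lebesgue K))"

definition ball_discrepancy :: "'a::euclidean_space set \<Rightarrow> 'a \<Rightarrow> real" where
  "ball_discrepancy K x = measure lebesgue (sym_diff K (ball x (eq_radius K))) / measure lebesgue K"

(* The minimum over all centres is written as an infimum (of a set of reals bounded below by 0);
   that it is attained at x is the equation in fraenkel_attained_at. *)
definition fraenkel_asymmetry :: "'a::euclidean_space set \<Rightarrow> real" where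
  "fraenkel_asymmetry K = (INF x. ball_discrepancy K x)"

definition fraenkel_attained_at :: "'a::euclidean_space set \<Rightarrow> 'a \<Rightarrow> bool" where
  "fraenkel_attained_at K x \<longleftrightarrow> ball_discrepancy K x = fraenkel_asymmetry K"

(* This formula is the reflection in the hyperplane {x. x \<bullet> w = l} only for norm w = 1. *)
definition hyp_reflection :: "real \<Rightarrow> 'a::euclidean_space \<Rightarrow> 'a \<Rightarrow> 'a" where
  "hyp_reflection l w x = x - (2 * (x \<bullet> w - l)) *\<^sub>R w"

definition cap :: "'a::euclidean_space set \<Rightarrow> real \<Rightarrow> 'a \<Rightarrow> 'a set" where
  "cap K l w = {x \<in> K. l \<le> x \<bullet> w}"

definition folding_levels :: "'a::euclidean_space set \<Rightarrow> 'a \<Rightarrow> real set" where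
  "folding_levels K w = {l. hyp_reflection l w ` cap K l w \<subseteq> K}"

(* The infimum is a minimum for every convex body: see max_folding_is_min below. *)
definition max_folding :: "'a::euclidean_space set \<Rightarrow> 'a \<Rightarrow> real" where
  "max_folding K w = Inf (folding_levels K w)"

definition heart :: "'a::euclidean_space set \<Rightarrow> 'a set" where
  "heart K = {x \<in> K. \<forall>w \<in> sphere 0 1. x \<bullet> w \<le> max_folding K w}"

lemma eq_radius_unique:
  fixes K :: "'a::euclidean_space set"
  shows "\<exists>!r. 0 \<le> r \<and> (\<forall>x::'a. measure lebesgue (ball x r) = measure lebesgue K)"
proof -
  define V where "V = unit_ball_vol (real DIM('a))"
  define m where "m = measure lebesgue K"
  have V: "V > 0" unfolding V_def by simp
  have m: "0 \<le> m" unfolding m_def by simp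
  have c: "measure lebesgue (ball x r) = V * r ^ DIM('a)" if "0 \<le> r" for x :: 'a and r
    using content_ball[OF that, of x] by (simp add: V_def)
  have e: "measure lebesgue (ball x r) = m \<longleftrightarrow> r ^ DIM('a) = m / V" if "0 \<le> r" for x :: 'a and r
    using V c[OF that, of x] by (auto simp: field_simps)
  show ?thesis
    unfolding m_def[symmetric]
  proof (rule ex1I[of _ "root DIM('a) (m / V)"])
    have nn: "0 \<le> root DIM('a) (m / V)" using m V by simp
    show "0 \<le> root DIM('a) (m / V) \<and>
        (\<forall>x::'a. measure lebesgue (ball x (root DIM('a) (m / V))) = m)"
      using nn m V e[OF nn] real_root_pow_pos2[of "DIM('a)" "m / V"] by auto
  next
    fix r assume "0 \<le> r \<and> (\<forall>x::'a. measure lebesgue (ball x r) = m)"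
    then show "r = root DIM('a) (m / V)"
      using e by (metis DIM_positive real_root_power_cancel)
  qed
qed

lemma max_folding_is_min:
  fixes K :: "'a::euclidean_space set"
  assumes "convex_body K" "norm w = 1"
  shows "max_folding K w \<in> folding_levels K w"
    and "\<And>l. l \<in> folding_levels K w \<Longrightarrow> max_folding K w \<le> l"
proof -
  have K: "compact K" "K \<noteq> {}"
    using assms(1) by (auto simp: convex_body_def)
  have ww: "w \<bullet> w = 1" using assms(2) by (simp add: dot_square_norm)
  have cont: "continuous_on K (\<lambda>x. x \<bullet> w)" by (intro continuous_intros)
  obtain a where a: "a \<in> K" "\<And>x. x \<in> K \<Longrightarrow> a \<bullet> w \<le> x \<bullet> w"
    using continuous_attains_inf[OF K cont] by blast
  obtain b where b: "b \<in> K" "\<And>x. x \<in> K \<Longrightarrow> x \<bullet> w \<le> b \<bullet> w"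
    using continuous_attains_sup[OF K cont] by blast
  have lower: "a \<bullet> w \<le> l" if l: "l \<in> folding_levels K w" for l
  proof (rule ccontr)
    assume "\<not> a \<bullet> w \<le> l"
    then have less: "l < a \<bullet> w" by simp
    then have "hyp_reflection l w a \<in> K"
      using l a(1) by (auto simp: folding_levels_def cap_def)
    from a(2)[OF this] show False
      using less ww by (simp add: hyp_reflection_def inner_diff_left)
  qed
  then have bdd: "bdd_below (folding_levels K w)" by (rule bdd_belowI)
  have "b \<bullet> w + 1 \<in> folding_levels K w"
    using b(2) by (force simp: folding_levels_def cap_def)
  then have ne: "folding_levels K w \<noteq> {}" by blast
  have "l \<in> folding_levels K w \<longleftrightarrow> (\<forall>x \<in> K. x \<bullet> w \<le> l \<or> hyp_reflection l w x \<in> K)" for l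
  proof -
    have "hyp_reflection l w x = x" if "x \<bullet> w = l" for x
      using that by (simp add: hyp_reflection_def)
    then show ?thesis by (fastforce simp: folding_levels_def cap_def)
  qed
  then have "folding_levels K w =
      (\<Inter>x \<in> K. {l. x \<bullet> w \<le> l} \<union> (\<lambda>l. hyp_reflection l w x) -` K)"
    by auto
  moreover have "closed ((\<lambda>l. hyp_reflection l w x) -` K)" for x
    using K(1) unfolding hyp_reflection_def
    by (intro closed_vimage compact_imp_closed continuous_intros) auto
  ultimately have cl: "closed (folding_levels K w)"
    by (simp add: closed_Collect_le closed_INT closed_Un)
  show "max_folding K w \<in> folding_levels K w"
    unfolding max_folding_def using closed_contains_Inf[OF ne bdd cl] .
  show "\<And>l. l \<in> folding_levels K w \<Longrightarrow> max_folding K w \<le> l"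
    unfolding max_folding_def using bdd by (rule cInf_lower[rotated])
qed

end

theory Submission
  imports Defs
begin

text \<open>
  Since the ball has the same measure as \<^term>\<open>K\<close>, the symmetric difference of the two is
  \<open>2 * (|K| - |K \<inter> ball x r|)\<close> in measure, so an optimal centre is a centre that maximizes the
  overlap \<open>|K \<inter> ball x r|\<close>. The proof finds such a maximizer in the heart.

  The engine is one folding inequality (\<open>folding_integral_nonpos\<close>). If the cap of \<open>K\<close> above the
  level \<open>l\<close> in direction \<open>w\<close> reflects into \<open>K\<close>, and \<open>h\<close> is odd under this reflection and nonpositive
  below the hyperplane, then the integral of \<open>h\<close> over \<open>K\<close> is nonpositive: the cap and its mirror image
  cancel, and what remains of \<open>K\<close> lies below the hyperplane. Two choices of \<open>h\<close> are used. With the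
  signed distance to the hyperplane, the inequality says that the barycenter of \<open>K\<close> lies on or below
  every folding hyperplane, hence in the heart (\<open>barycenter_in_heart\<close>). With the difference of the
  indicators of a ball centred above the hyperplane and of its mirror image, it says that moving the
  centre to its mirror image does not decrease the overlap (\<open>overlap_le_hyp_reflection\<close>).

  The overlap is continuous in the centre and attains its maximum, so the set of maximizers is closed
  and nonempty; let \<open>x\<close> be a maximizer nearest to the barycenter \<open>g\<close>. If \<open>x\<close> were above the
  hyperplane of the maximal folding in some direction, then it would also be above one of slightly
  larger level, which by convexity is a folding level too and has \<open>g\<close> strictly below it. The mirror
  image of \<open>x\<close> in the latter hyperplane would be a maximizer strictly closer to \<open>g\<close>, which is
  impossible. So \<open>x\<close> satisfies all the inequalities that define the heart, and these
  already force \<open>x \<in> K\<close> (\<open>heart_eq_folding_halfspaces\<close>).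

  The folding inequality rests on the invariance of Lebesgue measure under reflections, obtained here
  for all surjective isometries of a Euclidean space from the Vitali covering theorem.
\<close>

section \<open>Invariance of Lebesgue measure under isometries\<close>

lemma emeasure_lborel_ball_indep_center:
  fixes x y :: "'a::euclidean_space"
  shows "emeasure lborel (ball x r) = emeasure lborel (ball y r)"
  by (cases "0 \<le> r") (auto simp: emeasure_ball ball_empty)

lemma isometry_image_ball:
  assumes "\<And>x y. dist (f x) (f y) = dist x y" "surj f"
  shows "f ` ball x r = ball (f x) r"
proof
  show "f ` ball x r \<subseteq> ball (f x) r"
    using assms(1) by auto
  show "ball (f x) r \<subseteq> f ` ball x r"
  proof
    fix z assume z: "z \<in> ball (f x) r"
    obtain y where y: "z = f y" using assms(2) by (rule surjE)
    then have "y \<in> ball x r" using z assms(1)[of x y] by simp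
    then show "z \<in> f ` ball x r" unfolding y by (rule imageI)
  qed
qed

lemma isometry_open_image:
  assumes "\<And>x y. dist (f x) (f y) = dist x y" "surj f" "open S"
  shows "open (f ` S)"
proof -
  have "\<exists>e>0. ball (f x) e \<subseteq> f ` S" if x: "x \<in> S" for x
  proof -
    obtain e where "e > 0" "ball x e \<subseteq> S"
      using \<open>open S\<close> x openE by blast
    then show ?thesis
      using image_mono[of "ball x e" S f] isometry_image_ball[OF assms(1,2), of x e] by auto
  qed
  then show ?thesis by (auto simp: open_contains_ball)
qed

text \<open>
  By Vitali's covering theorem, \<open>S\<close> is a countable disjoint union of open balls up to a null set. The
  images of these balls are disjoint balls of the same radii inside \<open>f ` S\<close>, so \<open>f ` S\<close> is at least as
  large. This one-sided estimate is free of any claim about images of null sets; the reverse one comes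
  from applying it to the inverse isometry.
\<close>

lemma isometry_emeasure_open_le:
  fixes f :: "'a::euclidean_space \<Rightarrow> 'a"
  assumes iso: "\<And>x y. dist (f x) (f y) = dist x y" and "surj f"
    and "open S"
  shows "emeasure lborel S \<le> emeasure lborel (f ` S)"
proof -
  note image_ball = isometry_image_ball[OF iso \<open>surj f\<close>]
  have inj: "inj f" by (metis iso dist_eq_0_iff injI)
  define K where "K = {(x, r). ball x r \<subseteq> S}"
  let ?B = "\<lambda>i. ball (fst i) (snd i)"
  have cover: "\<exists>i. i \<in> K \<and> x \<in> ?B i \<and> snd i < d" if "x \<in> S" "0 < d" for x d
  proof -
    obtain e where e: "e > 0" "ball x e \<subseteq> S"
      using \<open>open S\<close> \<open>x \<in> S\<close> openE by blast
    have "ball x (min e (d/2)) \<subseteq> S" using e(2) by auto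
    then have "(x, min e (d/2)) \<in> K" by (simp add: K_def)
    moreover have "min e (d/2) < d" using that(2) by linarith
    ultimately show ?thesis using e(1) that(2)
      by (intro exI[of _ "(x, min e (d/2))"]) simp
  qed
  obtain C where C: "countable C" "C \<subseteq> K"
      "pairwise (\<lambda>i j. disjnt (?B i) (?B j)) C"
      "negligible (S - (\<Union>i\<in>C. ?B i))"
    by (rule Vitali_covering_theorem_balls[where S=S and K=K and a=fst and r=snd, OF cover])
      (assumption | rule that)+
  have disj: "disjoint_family_on ?B C"
    using C(3) by (auto simp: disjoint_family_on_def pairwise_def disjnt_def)
  have disj': "disjoint_family_on (\<lambda>i. f ` ?B i) C"
    using disj inj unfolding disjoint_family_on_def
    by (metis image_Int image_empty)
  have sub: "(\<Union>i\<in>C. ?B i) \<subseteq> S" using C(2) unfolding K_def by fastforce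
  have open_U: "open (\<Union>i\<in>C. ?B i)" by auto
  have null: "S - (\<Union>i\<in>C. ?B i) \<in> null_sets lborel"
    using C(4) \<open>open S\<close> open_U
    by (simp add: negligible_iff_null_sets null_sets_completion_iff)
  have "emeasure lborel S = emeasure lborel (S - (S - (\<Union>i\<in>C. ?B i)))"
    using emeasure_Diff_null_set[OF null] \<open>open S\<close> by simp
  also have "S - (S - (\<Union>i\<in>C. ?B i)) = (\<Union>i\<in>C. ?B i)" using sub by blast
  also have "emeasure lborel \<dots> = (\<integral>\<^sup>+i. emeasure lborel (?B i) \<partial>count_space C)"
    by (rule emeasure_UN_countable) (use C(1) disj in auto)
  also have "\<dots> = (\<integral>\<^sup>+i. emeasure lborel (f ` ?B i) \<partial>count_space C)"
    by (intro nn_integral_cong) (simp only: image_ball, rule emeasure_lborel_ball_indep_center)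
  also have "\<dots> = emeasure lborel (\<Union>i\<in>C. f ` ?B i)"
    by (rule emeasure_UN_countable[symmetric]) (use C(1) disj' in \<open>auto simp: image_ball\<close>)
  also have "\<dots> \<le> emeasure lborel (f ` S)"
    using sub isometry_open_image[OF iso \<open>surj f\<close> \<open>open S\<close>] by (intro emeasure_mono) auto
  finally show ?thesis .
qed

text \<open>
  Lebesgue measure is determined by its values on open boxes, and these are open sets, to which the
  estimate above applies for \<open>f\<close> and for its inverse.
\<close>

lemma distr_lborel_isometry:
  fixes f :: "'a::euclidean_space \<Rightarrow> 'a"
  assumes iso: "\<And>x y. dist (f x) (f y) = dist x y" and "surj f"
  shows "distr lborel lborel f = lborel"
proof (rule lborel_eqI[symmetric])
  have inj: "inj f" by (metis iso dist_eq_0_iff injI)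
  have bij: "bij f" using inj \<open>surj f\<close> by (simp add: bij_def)
  have "continuous_on UNIV f"
    unfolding continuous_on_iff by (metis iso)
  then have meas: "f \<in> borel_measurable borel" by (rule borel_measurable_continuous_onI)
  have inv_iso: "dist (inv f x) (inv f y) = dist x y" for x y
    by (metis iso \<open>surj f\<close> surj_f_inv_f)
  have inv_surj: "surj (inv f)" using inj by (rule inj_imp_surj_inv)
  show "sets (distr lborel lborel f) = sets borel" by simp
  fix l u :: 'a assume lu: "\<And>b. b \<in> Basis \<Longrightarrow> l \<bullet> b \<le> u \<bullet> b"
  have vimage: "f -` box l u = inv f ` box l u"
    by (rule bij_vimage_eq_inv_image[OF bij])
  have "open (f -` box l u)"
    using \<open>continuous_on UNIV f\<close> open_box by (rule open_vimage[rotated])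
  then have "emeasure lborel (inv f ` box l u) \<le> emeasure lborel (f ` inv f ` box l u)"
    unfolding vimage by (rule isometry_emeasure_open_le[OF iso \<open>surj f\<close>])
  moreover have "f ` inv f ` box l u = box l u"
    using \<open>surj f\<close> by (simp add: image_f_inv_f)
  moreover have "emeasure lborel (box l u) \<le> emeasure lborel (inv f ` box l u)"
    by (rule isometry_emeasure_open_le[OF inv_iso inv_surj open_box])
  ultimately have "emeasure lborel (f -` box l u) = emeasure lborel (box l u)"
    unfolding vimage by (metis order_antisym)
  then show "emeasure (distr lborel lborel f) (box l u) = (\<Prod>b\<in>Basis. (u - l) \<bullet> b)"
    using meas lu by (simp add: emeasure_distr)
qed

section \<open>Reflections in a hyperplane\<close>

lemma hyp_reflection_inner:
  assumes "norm w = 1"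
  shows "hyp_reflection l w x \<bullet> w = 2 * l - x \<bullet> w"
  using assms by (simp add: hyp_reflection_def inner_diff_left norm_eq_1)

lemma hyp_reflection_involution:
  assumes "norm w = 1"
  shows "hyp_reflection l w (hyp_reflection l w x) = x"
proof -
  have "hyp_reflection l w (hyp_reflection l w x)
      = hyp_reflection l w x - (2 * (2 * l - x \<bullet> w - l)) *\<^sub>R w"
    unfolding hyp_reflection_def[of l w "hyp_reflection l w x"]
    by (simp add: hyp_reflection_inner[OF assms])
  then show ?thesis by (simp add: hyp_reflection_def algebra_simps)
qed

text \<open>
  Reflecting \<open>x\<close> brings it closer to \<open>y\<close> exactly when \<open>x\<close> and \<open>y\<close> lie on opposite sides of the
  hyperplane.
\<close>

lemma dist_hyp_reflection:
  assumes "norm w = 1"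
  shows "(dist (hyp_reflection l w x) y)\<^sup>2 = (dist x y)\<^sup>2 + 4 * (x \<bullet> w - l) * (y \<bullet> w - l)"
proof -
  have ww: "w \<bullet> w = 1" using assms by (simp add: norm_eq_1)
  define a where "a = x \<bullet> w - l"
  have "(dist (hyp_reflection l w x) y)\<^sup>2 = ((x - y) - (2 * a) *\<^sub>R w) \<bullet> ((x - y) - (2 * a) *\<^sub>R w)"
    by (simp add: dist_norm power2_norm_eq_inner hyp_reflection_def a_def algebra_simps)
  also have "\<dots> = (x - y) \<bullet> (x - y) - 4 * a * ((x - y) \<bullet> w) + 4 * a\<^sup>2"
    by (simp add: inner_diff_left inner_diff_right inner_commute ww algebra_simps power2_eq_square)
  also have "\<dots> = (dist x y)\<^sup>2 + 4 * a * (y \<bullet> w - l)"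
    by (simp add: dist_norm power2_norm_eq_inner[symmetric] inner_diff_left a_def)
      (simp add: algebra_simps power2_eq_square)
  finally show ?thesis by (simp add: a_def)
qed

lemma isometry_hyp_reflection:
  assumes "norm w = 1"
  shows "dist (hyp_reflection l w x) (hyp_reflection l w y) = dist x y"
proof -
  have "(dist (hyp_reflection l w x) (hyp_reflection l w y))\<^sup>2 = (dist x y)\<^sup>2"
    using assms
    by (simp add: dist_hyp_reflection dist_commute[of x "hyp_reflection l w y"]
        dist_commute[of y x] hyp_reflection_inner algebra_simps)
  then show ?thesis by (simp add: power2_eq_iff_nonneg)
qed

lemma surj_hyp_reflection:
  assumes "norm w = 1"
  shows "surj (hyp_reflection l w)"
  by (metis assms hyp_reflection_involution surjI)

lemma distr_lborel_hyp_reflection: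
  fixes w :: "'a::euclidean_space"
  assumes "norm w = 1"
  shows "distr lborel lborel (hyp_reflection l w) = lborel"
  by (rule distr_lborel_isometry[OF isometry_hyp_reflection surj_hyp_reflection]) (use assms in auto)

lemma borel_measurable_hyp_reflection [measurable]:
  "hyp_reflection l w \<in> borel_measurable borel"
  unfolding hyp_reflection_def[abs_def] by (intro borel_measurable_continuous_onI continuous_intros)

section \<open>The folding inequality\<close>

text \<open>
  Because \<open>h\<close> is odd, its integrals over the cap and over the mirror image of the cap cancel. Both
  sets lie in \<open>S\<close>, and the rest of \<open>S\<close> lies in the half-space where \<open>h\<close> is nonpositive.
\<close>

lemma folding_integral_nonpos:
  fixes S :: "'a::euclidean_space set" and h :: "'a \<Rightarrow> real"
  assumes l: "l \<in> folding_levels S w" and w: "norm w = 1"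
    and S: "S \<in> sets borel"
    and int: "integrable lborel (\<lambda>x. indicator S x * h x)"
    and odd: "\<And>x. h (hyp_reflection l w x) = - h x"
    and nonpos: "\<And>x. x \<bullet> w \<le> l \<Longrightarrow> h x \<le> 0"
  shows "(\<integral>x. indicator S x * h x \<partial>lborel) \<le> 0"
proof -
  let ?T = "hyp_reflection l w"
  \<comment> \<open>The strict inequality makes \<open>P\<close> and its mirror image disjoint.\<close>
  define P where "P = S \<inter> {x. l < x \<bullet> w}"
  define g where "g = (\<lambda>x. indicator P x * h x)"
  have P [measurable]: "P \<in> sets borel"
    unfolding P_def using S by measurable
  have "integrable lborel (\<lambda>x. indicator P x * (indicator S x * h x))"
    using integrable_mult_indicator[OF _ int, of P] P by simp
  moreover have "indicator P x * (indicator S x * h x) = g x" for x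
    by (auto simp: g_def P_def indicator_def)
  ultimately have g: "integrable lborel g" by simp
  note distr = distr_lborel_hyp_reflection[OF w, of l]
  have gm [measurable]: "g \<in> borel_measurable borel" using g by (simp add: integrable_iff_bounded)
  have gT: "integrable lborel (\<lambda>x. g (?T x))"
    using g by (subst (asm) distr[symmetric], subst (asm) integrable_distr_eq) auto
  have "(\<integral>x. g x \<partial>lborel) = (\<integral>x. g (?T x) \<partial>lborel)"
    by (subst (1) distr[symmetric], subst integral_distr) auto
  \<comment> \<open>As \<open>g (?T x)\<close> is minus \<open>h\<close> on the mirror image of \<open>P\<close>, the new integrand is \<open>h\<close> on \<open>S\<close>
    without \<open>P\<close> and without that mirror image.\<close>
  then have "(\<integral>x. indicator S x * h x \<partial>lborel)
      = (\<integral>x. indicator S x * h x \<partial>lborel) - (\<integral>x. g x \<partial>lborel) + (\<integral>x. g (?T x) \<partial>lborel)"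
    by simp
  also have "\<dots> = (\<integral>x. indicator S x * h x - g x + g (?T x) \<partial>lborel)"
    using int g gT by simp
  also have "\<dots> \<le> (\<integral>(x::'a). 0 \<partial>lborel)"
  proof (rule Bochner_Integration.integral_mono)
    show "integrable lborel (\<lambda>x. indicator S x * h x - g x + g (?T x))"
      using int g gT by simp
    fix x
    show "indicator S x * h x - g x + g (?T x) \<le> 0"
    proof (cases "l < x \<bullet> w")
      case True
      then have "?T x \<notin> P" by (simp add: P_def hyp_reflection_inner[OF w])
      moreover have "x \<in> P \<longleftrightarrow> x \<in> S" using True by (simp add: P_def)
      ultimately show ?thesis by (simp add: g_def indicator_def)
    next
      case False
      have "x \<in> S" if "?T x \<in> P"
      proof -
        have "?T x \<in> cap S l w" using that by (simp add: P_def cap_def)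
        then have "?T (?T x) \<in> S" using l by (auto simp: folding_levels_def)
        then show ?thesis by (simp add: hyp_reflection_involution[OF w])
      qed
      then show ?thesis using False nonpos[of x]
        by (auto simp: g_def P_def indicator_def odd)
    qed
  qed simp
  finally show ?thesis by simp
qed

text \<open>
  The mirror image of a point \<open>x\<close> in the hyperplane of level \<open>m\<close> is on the segment from \<open>x\<close> to its
  mirror image in the lower hyperplane of level \<open>l\<close>.
\<close>

lemma folding_levels_upward_closed:
  fixes K :: "'a::euclidean_space set"
  assumes "convex K" "l \<in> folding_levels K w" "l \<le> m"
  shows "m \<in> folding_levels K w"
proof -
  have "hyp_reflection m w x \<in> K" if x: "x \<in> K" "m \<le> x \<bullet> w" for x
  proof (cases "x \<bullet> w = l")
    case True
    then have "m = x \<bullet> w" using x assms(3) by simp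
    then show ?thesis using x by (simp add: hyp_reflection_def)
  next
    case False
    then have pos: "0 < x \<bullet> w - l" using x assms(3) by simp
    define t where "t = (x \<bullet> w - m) / (x \<bullet> w - l)"
    have t: "0 \<le> t" "t \<le> 1" "t * (x \<bullet> w - l) = x \<bullet> w - m"
      using pos x assms(3) by (auto simp: t_def)
    have "hyp_reflection l w x \<in> K"
      using assms(2) x assms(3) by (auto simp: folding_levels_def cap_def)
    then have "(1 - t) *\<^sub>R x + t *\<^sub>R hyp_reflection l w x \<in> K"
      using assms(1) x t by (simp add: convex_alt)
    also have "(1 - t) *\<^sub>R x + t *\<^sub>R hyp_reflection l w x = x - (2 * (t * (x \<bullet> w - l))) *\<^sub>R w"
      by (simp add: hyp_reflection_def algebra_simps)
    also have "\<dots> = hyp_reflection m w x" by (simp only: t hyp_reflection_def)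
    finally show ?thesis .
  qed
  then show ?thesis by (auto simp: folding_levels_def cap_def)
qed

section \<open>The heart and the barycenter\<close>

text \<open>
  A point outside \<open>K\<close> is separated from \<open>K\<close> by a hyperplane. In the direction that points away from
  \<open>K\<close>, the cap above this hyperplane is empty, so its level is a folding level, and the point violates
  the inequality for this direction.
\<close>

lemma heart_eq_folding_halfspaces:
  fixes K :: "'a::euclidean_space set"
  assumes "convex_body K"
  shows "heart K = {x. \<forall>w \<in> sphere 0 1. x \<bullet> w \<le> max_folding K w}"
proof -
  have "x \<in> K" if x: "\<forall>w \<in> sphere 0 1. x \<bullet> w \<le> max_folding K w" for x
  proof (rule ccontr)
    assume "x \<notin> K"
    moreover have "convex K" "closed K"
      using assms by (auto simp: convex_body_def compact_imp_closed)
    ultimately obtain a b where ab: "a \<bullet> x < b" "\<And>y. y \<in> K \<Longrightarrow> b < a \<bullet> y"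
      using separating_hyperplane_closed_point by metis
    have "K \<noteq> {}" using assms by (auto simp: convex_body_def)
    then have "a \<noteq> 0" using ab by force
    define w where "w = - (a /\<^sub>R norm a)"
    have w: "norm w = 1" using \<open>a \<noteq> 0\<close> by (simp add: w_def)
    have inner: "y \<bullet> w = - (a \<bullet> y) / norm a" for y
      by (simp add: w_def inner_commute divide_inverse)
    have "\<And>y. y \<in> K \<Longrightarrow> y \<bullet> w < - b / norm a"
      using ab(2) \<open>a \<noteq> 0\<close> by (simp add: inner divide_strict_right_mono)
    then have "cap K (- b / norm a) w = {}" by (force simp: cap_def)
    then have "- b / norm a \<in> folding_levels K w" by (simp add: folding_levels_def)
    then have "max_folding K w \<le> - b / norm a"
      by (rule max_folding_is_min(2)[OF assms w])
    also have "\<dots> < x \<bullet> w"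
      using ab(1) \<open>a \<noteq> 0\<close> by (simp add: inner divide_strict_right_mono)
    finally show False using x w by force
  qed
  then show ?thesis by (auto simp: heart_def)
qed

definition barycenter :: "'a::euclidean_space set \<Rightarrow> 'a" where
  "barycenter K = (\<integral>x. indicator K x *\<^sub>R x \<partial>lborel) /\<^sub>R measure lborel K"

lemma convex_body_measure_pos:
  fixes K :: "'a::euclidean_space set"
  assumes "convex_body K"
  shows "0 < measure lborel K"
proof -
  have "compact K" "interior K \<noteq> {}" using assms by (auto simp: convex_body_def)
  then have "K \<in> lmeasurable" "\<not> negligible K"
    using lmeasurable_compact open_not_negligible[of "interior K"] negligible_subset[OF _ interior_subset]
    by auto
  then have "0 < measure lebesgue K" using measure_eq_0_null_sets negligible_iff_measure0
    by (metis zero_less_measure_iff)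
  also have "measure lebesgue K = measure lborel K"
    using \<open>compact K\<close> by (simp add: measure_completion borel_compact)
  finally show ?thesis .
qed

text \<open>This is the folding inequality for the signed distance \<open>x \<bullet> w - l\<close> to the hyperplane.\<close>

lemma barycenter_in_heart:
  fixes K :: "'a::euclidean_space set"
  assumes "convex_body K"
  shows "barycenter K \<in> heart K"
proof -
  have "barycenter K \<bullet> w \<le> max_folding K w" if "w \<in> sphere 0 1" for w
  proof -
    have w: "norm w = 1" using that by simp
    have K: "compact K" using assms by (simp add: convex_body_def)
    then have Kb: "K \<in> sets borel" by (rule borel_compact)
    define l where "l = max_folding K w"
    have l: "l \<in> folding_levels K w"
      unfolding l_def by (rule max_folding_is_min(1)[OF assms w])
    have int: "integrable lborel (\<lambda>x. indicator K x *\<^sub>R x)"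
      by (rule borel_integrable_compact[OF K]) (intro continuous_intros)
    have one: "integrable lborel (\<lambda>x. indicator K x :: real)"
      using borel_integrable_compact[OF K, of "\<lambda>x. 1::real"] by simp
    have split: "indicator K x * (x \<bullet> w - l) = (indicator K x *\<^sub>R x) \<bullet> w - l * indicator K x" for x
      by (simp add: algebra_simps)
    note inner_int = integrable_inner_left[OF int, of w] integral_inner_left[OF int, of w]
    have "(\<integral>x. indicator K x * (x \<bullet> w - l) \<partial>lborel) \<le> 0"
    proof (rule folding_integral_nonpos[OF l w Kb])
      show "integrable lborel (\<lambda>x. indicator K x * (x \<bullet> w - l))"
        unfolding split using one by (intro Bochner_Integration.integrable_diff inner_int) simp
    qed (simp_all add: hyp_reflection_inner[OF w])
    moreover have "(\<integral>x. indicator K x * (x \<bullet> w - l) \<partial>lborel)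
        = (\<integral>x. indicator K x *\<^sub>R x \<partial>lborel) \<bullet> w - l * measure lborel K"
      unfolding split using one
      by (subst Bochner_Integration.integral_diff) (simp_all only: inner_int integrable_mult_right integral_mult_right_zero, simp)
    ultimately have "(\<integral>x. indicator K x *\<^sub>R x \<partial>lborel) \<bullet> w \<le> l * measure lborel K" by simp
    then show ?thesis
      using convex_body_measure_pos[OF assms] by (simp add: barycenter_def l_def field_simps)
  qed
  then show ?thesis by (simp add: heart_eq_folding_halfspaces[OF assms])
qed

section \<open>The overlap of a convex body with a moving ball\<close>

text \<open>
  Points below the hyperplane are at least as close to the mirror image of \<open>x\<close> as to \<open>x\<close>. So below
  the hyperplane, the ball about \<open>x\<close> is contained in its mirror image, and the difference of
  the two indicators is a function to which the folding inequality applies.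
\<close>

lemma overlap_le_hyp_reflection:
  fixes K :: "'a::euclidean_space set"
  assumes K: "compact K" and l: "l \<in> folding_levels K w" and w: "norm w = 1"
    and x: "l \<le> x \<bullet> w"
  shows "measure lborel (K \<inter> ball x r) \<le> measure lborel (K \<inter> ball (hyp_reflection l w x) r)"
proof -
  let ?T = "hyp_reflection l w"
  define h :: "'a \<Rightarrow> real" where "h y = indicator (ball x r) y - indicator (ball (?T x) r) y" for y
  have Kb [measurable]: "K \<in> sets borel" using K by (rule borel_compact)
  have int: "integrable lborel (\<lambda>y. indicator (K \<inter> ball z r) y :: real)" for z
  proof (rule integrable_real_indicator)
    show "emeasure lborel (K \<inter> ball z r) < \<infinity>"
      using K by (intro emeasure_bounded_finite bounded_Int) (auto simp: compact_imp_bounded)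
  qed auto
  have split: "indicator K y * h y = indicator (K \<inter> ball x r) y - indicator (K \<inter> ball (?T x) r) y" for y
    by (simp add: h_def indicator_inter_arith algebra_simps)
  have "(\<integral>y. indicator K y * h y \<partial>lborel) \<le> 0"
  proof (rule folding_integral_nonpos[OF l w Kb])
    show "integrable lborel (\<lambda>y. indicator K y * h y)"
      unfolding split using int by simp
    show "h (?T y) = - h y" for y
      using isometry_hyp_reflection[OF w, of l x y] isometry_hyp_reflection[OF w, of l "?T x" y]
      by (simp add: h_def indicator_def hyp_reflection_involution[OF w])
    show "h y \<le> 0" if "y \<bullet> w \<le> l" for y
    proof -
      have "4 * (x \<bullet> w - l) * (y \<bullet> w - l) \<le> 0"
        using x that by (simp add: mult_nonneg_nonpos)
      then have "(dist (?T x) y)\<^sup>2 \<le> (dist x y)\<^sup>2"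
        by (simp add: dist_hyp_reflection[OF w])
      then have "dist (?T x) y \<le> dist x y" by (simp add: power2_le_iff_abs_le)
      then show ?thesis by (auto simp: h_def indicator_def)
    qed
  qed
  also have "(\<integral>y. indicator K y * h y \<partial>lborel)
      = measure lborel (K \<inter> ball x r) - measure lborel (K \<inter> ball (?T x) r)"
    unfolding split using int by simp
  finally show ?thesis by simp
qed

text \<open>
  The ball about \<open>y\<close> is contained in the concentric enlargement of the ball about \<open>x\<close> by
  \<open>dist x y\<close>, so the overlap grows at most by the measure of an annulus that shrinks with \<open>dist x y\<close>.
\<close>

lemma overlap_ball_diff_le:
  fixes K :: "'a::euclidean_space set"
  assumes K: "K \<in> sets borel" and r: "0 \<le> r"
  shows "measure lborel (K \<inter> ball y r) - measure lborel (K \<inter> ball x r)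
    \<le> unit_ball_vol (real DIM('a)) * ((r + dist x y) ^ DIM('a) - r ^ DIM('a))"
proof -
  have fm: "A \<inter> ball z s \<in> fmeasurable lborel" if "A \<in> sets borel" for A and z :: 'a and s
    using that by (intro fmeasurableI) (auto intro!: emeasure_bounded_finite[unfolded infinity_ennreal_def] bounded_Int)
  have fmb: "ball z s \<in> fmeasurable lborel" for z :: 'a and s
    using fm[of UNIV] by simp
  have sub: "ball y r \<subseteq> ball x (r + dist x y)" "ball x r \<subseteq> ball x (r + dist x y)"
    by (auto simp: ball_subset_ball_iff dist_commute)
  have "measure lborel (K \<inter> ball y r)
      \<le> measure lborel ((K \<inter> ball x r) \<union> (ball x (r + dist x y) - ball x r))"
    using sub(1) K by (intro measure_mono_fmeasurable fmeasurable.Un fm fmeasurable.Diff fmb) auto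
  also have "\<dots> \<le> measure lborel (K \<inter> ball x r) + measure lborel (ball x (r + dist x y) - ball x r)"
    using K by (intro measure_Un_le) auto
  also have "measure lborel (ball x (r + dist x y) - ball x r)
      = measure lborel (ball x (r + dist x y)) - measure lborel (ball x r)"
    using sub(2) fmb by (intro measurable_measure_Diff) auto
  also have "\<dots> = unit_ball_vol (real DIM('a)) * ((r + dist x y) ^ DIM('a) - r ^ DIM('a))"
    using content_ball[of r x] content_ball[of "r + dist x y" x] r
    by (simp add: measure_completion right_diff_distrib)
  finally show ?thesis by simp
qed

lemma continuous_on_overlap_ball:
  fixes K :: "'a::euclidean_space set"
  assumes "K \<in> sets borel" "0 \<le> r"
  shows "continuous_on UNIV (\<lambda>x. measure lborel (K \<inter> ball x r))"
proof -
  define b where "b x y = unit_ball_vol (real DIM('a)) * ((r + dist x y) ^ DIM('a) - r ^ DIM('a))" for x y :: 'a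
  have "((\<lambda>y. measure lborel (K \<inter> ball y r)) \<longlongrightarrow> measure lborel (K \<inter> ball x r)) (at x)" for x
  proof (rule LIM_zero_cancel, rule Lim_null_comparison)
    show "\<forall>\<^sub>F y in at x. norm (measure lborel (K \<inter> ball y r) - measure lborel (K \<inter> ball x r)) \<le> b x y"
      using overlap_ball_diff_le[OF assms, of _ x] overlap_ball_diff_le[OF assms, of x]
      by (intro always_eventually) (auto simp: b_def abs_le_iff dist_commute)
    have "((\<lambda>y. b x y) \<longlongrightarrow> unit_ball_vol (real DIM('a)) * ((r + dist x x) ^ DIM('a) - r ^ DIM('a))) (at x)"
      unfolding b_def by (intro tendsto_intros)
    then show "((\<lambda>y. b x y) \<longlongrightarrow> 0) (at x)" by simp
  qed
  then show ?thesis by (simp add: continuous_on_def)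
qed

lemma overlap_ball_attains_max:
  fixes K :: "'a::euclidean_space set"
  assumes K: "compact K" and r: "0 \<le> r"
  shows "\<exists>x. \<forall>y. measure lborel (K \<inter> ball y r) \<le> measure lborel (K \<inter> ball x r)"
proof (cases "K = {}")
  case False
  let ?f = "\<lambda>x. measure lborel (K \<inter> ball x r)"
  \<comment> \<open>The overlap vanishes outside the compact set of centres at distance at most \<open>r\<close> from \<open>K\<close>.\<close>
  let ?C = "{x + y | x y. x \<in> K \<and> y \<in> cball 0 r}"
  have Kb: "K \<in> sets borel" using K by (rule borel_compact)
  have "compact ?C" using K by (intro compact_sums) auto
  moreover have "?C \<noteq> {}" 
  proof -
    obtain k where "k \<in> K" using False by blast
    moreover have "0 \<in> cball (0::'a) r" using r by simp
    ultimately show ?thesis by blast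
  qed
  moreover have "continuous_on ?C ?f"
    using continuous_on_overlap_ball[OF Kb r] by (rule continuous_on_subset) simp
  ultimately have "\<exists>x\<in>?C. \<forall>y\<in>?C. ?f y \<le> ?f x"
    by (rule continuous_attains_sup)
  then obtain x where x: "\<And>y. y \<in> ?C \<Longrightarrow> ?f y \<le> ?f x" by blast
  have "?f y \<le> ?f x" for y
  proof (cases "K \<inter> ball y r = {}")
    case True
    then show ?thesis by simp
  next
    case False
    then obtain z where "z \<in> K" "z \<in> ball y r" by blast
    then have "y = z + (y - z) \<and> z \<in> K \<and> y - z \<in> cball 0 r" by (simp add: dist_norm norm_minus_commute)
    then have "y \<in> ?C" by blast
    then show ?thesis by (rule x)
  qed
  then show ?thesis by blast
qed simp

text \<open>
  The maximizer of the overlap nearest to the barycenter is in the heart: a folding hyperplane strictly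
  between the two would reflect it to a maximizer still nearer to the barycenter.
\<close>

lemma overlap_maximizer_in_heart:
  fixes K :: "'a::euclidean_space set"
  assumes body: "convex_body K" and r: "0 \<le> r"
  shows "\<exists>x \<in> heart K. \<forall>y. measure lborel (K \<inter> ball y r) \<le> measure lborel (K \<inter> ball x r)"
proof -
  let ?f = "\<lambda>x. measure lborel (K \<inter> ball x r)"
  let ?g = "barycenter K"
  have K: "compact K" "convex K" using body by (auto simp: convex_body_def)
  obtain m where m: "\<And>y. ?f y \<le> ?f m" using overlap_ball_attains_max[OF K(1) r] by blast
  define M where "M = ?f -` {?f m}"
  have "closed M" unfolding M_def
    using continuous_on_overlap_ball[OF borel_compact[OF K(1)] r]
    by (intro closed_vimage) auto
  moreover have "M \<noteq> {}" by (auto simp: M_def)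
  ultimately obtain x where x: "x \<in> M" "\<And>y. y \<in> M \<Longrightarrow> dist ?g x \<le> dist ?g y"
    using distance_attains_inf by metis
  have "x \<bullet> w \<le> max_folding K w" if "w \<in> sphere 0 1" for w
  proof (rule ccontr)
    have w: "norm w = 1" using that by simp
    assume "\<not> x \<bullet> w \<le> max_folding K w"
    \<comment> \<open>The barycenter may lie on the hyperplane of level \<^term>\<open>max_folding K w\<close>, and reflecting
      there would preserve the distance to it; a larger level makes the distance decrease strictly.\<close>
    then obtain l where l: "max_folding K w < l" "l < x \<bullet> w"
      using dense by (metis not_le)
    have lev: "l \<in> folding_levels K w"
      using folding_levels_upward_closed[OF K(2) max_folding_is_min(1)[OF body w]] l(1) by simp
    let ?x = "hyp_reflection l w x"
    have "?f x \<le> ?f ?x"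
      by (rule overlap_le_hyp_reflection[OF K(1) lev w]) (use l in simp)
    then have "?x \<in> M" using x(1) m[of ?x] by (simp add: M_def)
    then have "dist ?g x \<le> dist ?g ?x" by (rule x(2))
    moreover have "(dist ?x ?g)\<^sup>2 < (dist x ?g)\<^sup>2"
    proof -
      have "?g \<bullet> w < l"
        using barycenter_in_heart[OF body] that l(1) by (force simp: heart_def)
      then have "4 * (x \<bullet> w - l) * (?g \<bullet> w - l) < 0" using l(2) by (simp add: mult_pos_neg)
      then show ?thesis by (simp add: dist_hyp_reflection[OF w])
    qed
    ultimately show False
      by (metis dist_commute not_le power_mono zero_le_dist)
  qed
  then have "x \<in> heart K" by (simp add: heart_eq_folding_halfspaces[OF body])
  then show ?thesis using x(1) m by (intro bexI[of _ x]) (auto simp: M_def)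
qed

section \<open>Fraenkel asymmetry\<close>

lemma ball_discrepancy_eq_overlap:
  fixes K :: "'a::euclidean_space set"
  assumes "compact K"
  shows "ball_discrepancy K x
    = 2 * (measure lebesgue K - measure lborel (K \<inter> ball x (eq_radius K))) / measure lebesgue K"
proof -
  let ?B = "ball x (eq_radius K)"
  have B: "measure lebesgue ?B = measure lebesgue K"
    using theI'[OF eq_radius_unique[of K]] by (simp add: eq_radius_def)
  have meas: "K \<in> lmeasurable" "?B \<in> lmeasurable"
    using assms by (auto simp: lmeasurable_compact)
  then have inter: "K \<inter> ?B \<in> sets lebesgue" by (intro sets.Int fmeasurableD)
  have "measure lebesgue (sym_diff K ?B) = measure lebesgue (K - ?B) + measure lebesgue (?B - K)"
  proof -
    have "(K - ?B) \<inter> (?B - K) = {}" by blast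
    then show ?thesis
      using measure_Un3[OF fmeasurable.Diff[OF meas] fmeasurable.Diff[OF meas(2,1)]] by simp
  qed
  also have "measure lebesgue (K - ?B) = measure lebesgue K - measure lebesgue (K \<inter> ?B)"
    using measurable_measure_Diff[OF meas(1) inter] by (simp add: Diff_Int)
  also have "measure lebesgue (?B - K) = measure lebesgue ?B - measure lebesgue (K \<inter> ?B)"
    using measurable_measure_Diff[OF meas(2) inter] by (simp add: Diff_Int)
  also have "measure lebesgue (K \<inter> ?B) = measure lborel (K \<inter> ?B)"
    using borel_compact[OF assms] by (intro measure_completion) simp
  finally show ?thesis by (simp add: ball_discrepancy_def B)
qed

theorem corollary3p14:
  fixes K :: "(real ^ 'n) set"
  assumes "convex_body K"
  shows "\<exists>x \<in> heart K. fraenkel_attained_at K x"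
proof -
  have K: "compact K" using assms by (simp add: convex_body_def)
  have "0 \<le> eq_radius K"
    using theI'[OF eq_radius_unique[of K]] by (simp add: eq_radius_def)
  then obtain x where x: "x \<in> heart K"
      "\<And>y. measure lborel (K \<inter> ball y (eq_radius K)) \<le> measure lborel (K \<inter> ball x (eq_radius K))"
    using overlap_maximizer_in_heart[OF assms] by blast
  have "ball_discrepancy K x \<le> ball_discrepancy K y" for y
    unfolding ball_discrepancy_eq_overlap[OF K]
    using x(2)[of y] by (intro divide_right_mono) auto
  then have "fraenkel_asymmetry K = ball_discrepancy K x"
    unfolding fraenkel_asymmetry_def by (intro cInf_eq_minimum) auto
  then have "fraenkel_attained_at K x" by (simp add: fraenkel_attained_at_def)
  with x(1) show ?thesis by blast
qed

end
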